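(* Let $n\ge 1$, let $Z:\Pi\to(0,\infty)$ be a knee-jerk function, let $x=(x_1,\ldots,x_n)\in\Sigma$, and write $x'=T_Z(x)$ and $Z'=Z(x')$, while $Z$ and $Z_{x_i}$ denote the values at $x$ of the function and of its partial derivatives. Then $$\log\frac{Z'}{Z}\;\ge\;\frac{x_1Z_{x_1}+\cdots+x_nZ_{x_n}}{Z}\,I(x';x)\;\ge\;0.$$ In particular, $Z'>Z$ unless the point $x$ is fixed by $T_Z$ (i.e. $T_Z(x)=x$), which happens if and only if $x$ is a critical point of $Z$ on $\Sigma$.
   Context: Let $\Pi=\{(x_1,\ldots,x_n)\in\mathbb{R}^n : x_1,\ldots,x_n>0\}$ be the positive orthant, with closure $\bar\Pi$ (the non-negative orthant), and let $\Sigma=\{(x_1,\ldots,x_n)\in\Pi : x_1+\cdots+x_n=1\}$, with closure $\bar\Sigma$. A function $Z:\Pi\to(0,\infty)$ is log-log-convex if $\log Z$ is a convex function of $u_1=\log x_1,\ldots,u_n=\log x_n$, i.e. if $(u_1,\ldots,u_n)\mapsto\log Z(e^{u_1},\ldots,e^{u_n})$ is convex on $\mathbb{R}^n$. A knee-jerk function is a function $Z:\Pi\to(0,\infty)$ that is smooth, increasing (meaning non-decreasing in each variable), log-log-convex, and extends continuously to $\bar\Pi$; the extension is also denoted $Z$. $Z_{x_i}$ denotes $\partial Z/\partial x_i$. The knee-jerk mapping $T_Z:\Pi\to\bar\Sigma$ of a knee-jerk function $Z$ is $$T_Z(x)=\frac{1}{x_1Z_{x_1}+\cdots+x_nZ_{x_n}}\,(x_1Z_{x_1},\ldots,x_nZ_{x_n}),$$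 with derivatives evaluated at $x$; at points where $Z_{x_1}=\cdots=Z_{x_n}=0$ one sets instead $T_Z(x)=\frac{1}{x_1+\cdots+x_n}(x_1,\ldots,x_n)$. Since $T_Z(x)$ may lie on the boundary of $\bar\Pi$, $Z(T_Z(x))$ is understood via the continuous extension. For $x\in\Sigma$ and $y\in\bar\Sigma$ the I-divergence is $I(y;x)=y_1\log\frac{y_1}{x_1}+\cdots+y_n\log\frac{y_n}{x_n}$, where a term with $y_i=0$ equals $0$. Also $\log 0=-\infty$ (so the inequality includes the assertion $Z'>0$). A critical point of $Z$ on $\Sigma$ is a critical point of the restriction of $Z$ to $\Sigma$, i.e. a point $x\in\Sigma$ at which the derivative of $Z$ vanishes in every direction $v\in\mathbb{R}^n$ with $v_1+\cdots+v_n=0$ (equivalently $Z_{x_1}=\cdots=Z_{x_n}$ at $x$). *)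

theory Defs
  imports "HOL-Analysis.Analysis"
begin

text \<open>Vectors in n-dimensional space, with n at least 1 arbitrary, are elements of \<open>real ^ 'n\<close>.\<close>

definition pos_orthant :: "(real ^ 'n) set" where
  "pos_orthant = {x. \<forall>i. 0 < x $ i}"

definition open_simplex :: "(real ^ 'n) set" where
  "open_simplex = {x \<in> pos_orthant. (\<Sum>i\<in>UNIV. x $ i) = 1}"

text \<open>Differentiability classes, for open domains \<open>S\<close>: the derivative is the two-sided
  derivative in the ambient space.\<close>

primrec C_k_on :: "nat \<Rightarrow> (real ^ 'n \<Rightarrow> real) \<Rightarrow> (real ^ 'n) set \<Rightarrow> bool" where
  "C_k_on 0 f S \<longleftrightarrow> continuous_on S f"
| "C_k_on (Suc k) f S \<longleftrightarrow>
     (\<forall>x\<in>S. f differentiable (at x)) \<and>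
     (\<forall>v. C_k_on k (\<lambda>x. frechet_derivative f (at x) v) S)"

definition smooth_on :: "(real ^ 'n) set \<Rightarrow> (real ^ 'n \<Rightarrow> real) \<Rightarrow> bool" where
  "smooth_on S f \<longleftrightarrow> (\<forall>k. C_k_on k f S)"

definition partial_deriv :: "(real ^ 'n \<Rightarrow> real) \<Rightarrow> 'n \<Rightarrow> real ^ 'n \<Rightarrow> real" where
  "partial_deriv Z i x = deriv (\<lambda>t. Z (x + t *\<^sub>R axis i 1)) 0"

definition nondecreasing_in_each_variable :: "(real ^ 'n \<Rightarrow> real) \<Rightarrow> bool" where
  "nondecreasing_in_each_variable Z \<longleftrightarrow>
     (\<forall>x\<in>pos_orthant. \<forall>i. mono_on {0<..} (\<lambda>t. Z (\<chi> j. if j = i then t else x $ j)))"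

definition log_log_convex :: "(real ^ 'n \<Rightarrow> real) \<Rightarrow> bool" where
  "log_log_convex Z \<longleftrightarrow> convex_on UNIV (\<lambda>u. ln (Z (\<chi> i. exp (u $ i))))"

text \<open>\<open>Z\<close> is a total function that already carries, on the boundary of the orthant, the values of
  the (unique) continuous extension. Its values outside the closed orthant are irrelevant.\<close>

definition knee_jerk :: "(real ^ 'n \<Rightarrow> real) \<Rightarrow> bool" where
  "knee_jerk Z \<longleftrightarrow>
     (\<forall>x\<in>pos_orthant. 0 < Z x) \<and>
     smooth_on pos_orthant Z \<and>
     nondecreasing_in_each_variable Z \<and>
     log_log_convex Z \<and>
     continuous_on (closure pos_orthant) Z"

definition knee_jerk_map :: "(real ^ 'n \<Rightarrow> real) \<Rightarrow> real ^ 'n \<Rightarrow> real ^ 'n" where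
  "knee_jerk_map Z x =
     (if \<forall>i. partial_deriv Z i x = 0
      then (1 / (\<Sum>i\<in>UNIV. x $ i)) *\<^sub>R x
      else (1 / (\<Sum>i\<in>UNIV. x $ i * partial_deriv Z i x)) *\<^sub>R
             (\<chi> i. x $ i * partial_deriv Z i x))"

definition I_divergence :: "real ^ 'n \<Rightarrow> real ^ 'n \<Rightarrow> real" where
  "I_divergence y x =
     (\<Sum>i\<in>UNIV. if y $ i = 0 then 0 else y $ i * ln (y $ i / x $ i))"

definition critical_point_on_simplex :: "(real ^ 'n \<Rightarrow> real) \<Rightarrow> real ^ 'n \<Rightarrow> bool" where
  "critical_point_on_simplex Z x \<longleftrightarrow>
     x \<in> open_simplex \<and>
     (\<forall>v. (\<Sum>i\<in>UNIV. v $ i) = 0 \<longrightarrow>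
        ((\<lambda>t. Z (x + t *\<^sub>R v)) has_real_derivative 0) (at 0))"

end

theory Submission
  imports Defs
begin

text \<open>
  Write \<open>D = \<Sum>i. x\<^sub>i Z\<^sub>i\<close>, where \<open>Z\<^sub>i\<close> are the partial derivatives at \<open>x\<close>.  They are nonnegative by
  monotonicity, so \<open>D > 0\<close> unless they all vanish, in which case \<open>x' = x\<close>.  In logarithmic
  coordinates \<open>u\<^sub>i = ln x\<^sub>i\<close> the gradient of \<open>ln Z\<close> is \<open>x\<^sub>i Z\<^sub>i / Z\<close>, which is \<open>D / Z\<close> times the
  image point \<open>x'\<close>.  A convex function lies above its tangent plane, so for \<open>y\<close> in the open orthant
  \<open>ln (Z y) - ln (Z x) \<ge> D / Z x * (\<Sum>i. x'\<^sub>i * ln (y\<^sub>i / x\<^sub>i))\<close> (\<open>log_tangent_inequality\<close>).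
  At \<open>y = x'\<close> the right-hand side is \<open>D / Z x\<close> times the I-divergence of \<open>x'\<close> from \<open>x\<close>, which is the
  claim.  The point \<open>x'\<close> may lie on the boundary; it is therefore approached through points that
  differ from it only in the coordinates where \<open>x'\<close> vanishes.  These coordinates have weight
  \<open>x'\<^sub>i = 0\<close>, so the bound is the same along the whole approach and passes to the limit by continuity
  of \<open>Z\<close> on the closed orthant (\<open>log_tangent_inequality_boundary\<close>).

  Strict growth away from fixed points is the strict Gibbs inequality (\<open>I_divergence_pos\<close>).
  Finally, \<open>x\<^sub>i Z\<^sub>i / D = x\<^sub>i\<close> for all \<open>i\<close> says that all partial derivatives are equal, which is
  criticality on the simplex; the exceptional case where all of them vanish fits this
  description too.
\<close>

section \<open>Differentiation\<close>

lemma has_real_derivative_along_curve: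
  fixes f :: "real ^ 'n \<Rightarrow> real" and c :: "real \<Rightarrow> real ^ 'n"
  assumes "(f has_derivative f') (at (c s))" "(c has_vector_derivative v) (at s)"
  shows "((\<lambda>t. f (c t)) has_real_derivative f' v) (at s)"
proof -
  have "((\<lambda>t. f (c t)) has_derivative (\<lambda>t. f' (t *\<^sub>R v))) (at s)"
    using has_derivative_compose[of c "\<lambda>t. t *\<^sub>R v" s UNIV f f'] assms
    by (simp add: has_vector_derivative_def)
  moreover have "(\<lambda>t. f' (t *\<^sub>R v)) = (*) (f' v)"
    using assms(1) by (auto simp: linear_cmul[OF has_derivative_linear])
  ultimately show ?thesis by (simp add: has_field_derivative_def)
qed

lemma has_real_derivative_along_line:
  fixes f :: "real ^ 'n \<Rightarrow> real"
  assumes "(f has_derivative f') (at x)"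
  shows "((\<lambda>t. f (x + t *\<^sub>R v)) has_real_derivative f' v) (at 0)"
proof (rule has_real_derivative_along_curve)
  show "(f has_derivative f') (at (x + 0 *\<^sub>R v))" using assms by simp
  show "((\<lambda>t. x + t *\<^sub>R v) has_vector_derivative v) (at 0)"
    by (auto intro!: derivative_eq_intros)
qed

lemma has_derivative_partial_deriv:
  fixes f :: "real ^ 'n \<Rightarrow> real"
  assumes "f differentiable (at x)"
  shows "(f has_derivative (\<lambda>v. \<Sum>i\<in>UNIV. v $ i * partial_deriv f i x)) (at x)"
proof -
  obtain f' where f': "(f has_derivative f') (at x)"
    using assms by (auto simp: differentiable_def)
  have lin: "linear f'" using f' by (rule has_derivative_linear)
  have pd: "partial_deriv f i x = f' (axis i 1)" for i
    unfolding partial_deriv_def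
    by (rule DERIV_imp_deriv[OF has_real_derivative_along_line[OF f']])
  have "f' v = (\<Sum>i\<in>UNIV. v $ i * partial_deriv f i x)" for v
  proof -
    have "f' v = f' (\<Sum>i\<in>UNIV. v $ i *\<^sub>R axis i 1)"
      using basis_expansion[of v] by (simp add: scalar_mult_eq_scaleR)
    then show ?thesis by (simp add: linear_sum[OF lin] linear_cmul[OF lin] pd)
  qed
  then have "f' = (\<lambda>v. \<Sum>i\<in>UNIV. v $ i * partial_deriv f i x)" by auto
  then show ?thesis using f' by simp
qed

lemma knee_jerk_has_derivative:
  assumes "knee_jerk Z" "x \<in> pos_orthant"
  shows "(Z has_derivative (\<lambda>v. \<Sum>i\<in>UNIV. v $ i * partial_deriv Z i x)) (at x)"
proof (rule has_derivative_partial_deriv)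
  have "C_k_on (Suc 0) Z pos_orthant"
    using assms(1) unfolding knee_jerk_def smooth_on_def by blast
  then show "Z differentiable (at x)" using assms(2) by simp
qed

lemma knee_jerk_partial_deriv_nonneg:
  assumes "knee_jerk Z" "x \<in> pos_orthant"
  shows "0 \<le> partial_deriv Z i x"
proof -
  let ?c = "\<lambda>t. (\<chi> j. if j = i then t else x $ j)"
  have c: "?c = (\<lambda>t. x + (t - x $ i) *\<^sub>R axis i 1)"
    by (auto simp: vec_eq_iff axis_def)
  have "((\<lambda>t. Z (?c t)) has_real_derivative
      (\<Sum>k\<in>UNIV. axis i 1 $ k * partial_deriv Z k x)) (at (x $ i))"
  proof (rule has_real_derivative_along_curve[where c = ?c and v = "axis i 1"
        and f' = "\<lambda>v. \<Sum>k\<in>UNIV. v $ k * partial_deriv Z k x"])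
    have "?c (x $ i) = x" by (simp add: vec_eq_iff)
    then show "(Z has_derivative (\<lambda>v. \<Sum>k\<in>UNIV. v $ k * partial_deriv Z k x)) (at (?c (x $ i)))"
      using knee_jerk_has_derivative[OF assms] by simp
    show "(?c has_vector_derivative axis i 1) (at (x $ i))"
      unfolding c by (auto intro!: derivative_eq_intros)
  qed
  moreover have "(\<Sum>k\<in>UNIV. axis i 1 $ k * partial_deriv Z k x) = partial_deriv Z i x"
    by (simp add: axis_def if_distrib[of "\<lambda>a. a * _"] cong: if_cong)
  ultimately have d: "((\<lambda>t. Z (?c t)) has_real_derivative partial_deriv Z i x) (at (x $ i))"
    by simp
  have "mono_on {0<..} (\<lambda>t. Z (?c t))"
    using assms unfolding knee_jerk_def nondecreasing_in_each_variable_def by blast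
  then show ?thesis
    by (rule mono_on_imp_deriv_nonneg[OF _ d])
      (use assms(2) in \<open>auto simp: pos_orthant_def interior_open\<close>)
qed

section \<open>The tangent inequality in logarithmic coordinates\<close>

text \<open>Convexity is used only along the line of logarithmic coordinates that joins \<open>x\<close> to \<open>y\<close>; in the
  orthant this line is the curve \<open>t \<mapsto> (x\<^sub>i (y\<^sub>i / x\<^sub>i) powr t)\<^sub>i\<close>.\<close>

lemma log_tangent_inequality:
  fixes Z :: "real ^ 'n \<Rightarrow> real"
  assumes Z: "knee_jerk Z" and x: "x \<in> pos_orthant" and y: "y \<in> pos_orthant"
  shows "ln (Z y) - ln (Z x)
    \<ge> (\<Sum>i\<in>UNIV. x $ i * partial_deriv Z i x * ln (y $ i / x $ i)) / Z x"
proof -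
  define w where "w i = ln (y $ i / x $ i)" for i
  define u where "u = (\<chi> i. ln (x $ i))"
  define c where "c t = (\<chi> i. x $ i * exp (t * w i))" for t
  have xp: "0 < x $ i" and yp: "0 < y $ i" for i using x y by (auto simp: pos_orthant_def)
  have Zx: "0 < Z x" using Z x by (auto simp: knee_jerk_def)
  have c0: "c 0 = x" by (simp add: c_def vec_eq_iff)
  have c1: "c 1 = y"
    using xp yp by (simp add: c_def vec_eq_iff w_def less_imp_neq[THEN not_sym])
  have c_exp: "c t = (\<chi> i. exp ((u + t *\<^sub>R (\<chi> i. w i)) $ i))" for t
    using xp by (simp add: c_def u_def exp_add vec_eq_iff)
  have "convex_on UNIV (\<lambda>v. ln (Z (\<chi> i. exp (v $ i))))"
    using Z by (auto simp: knee_jerk_def log_log_convex_def)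
  then have conv: "convex_on UNIV (\<lambda>t. ln (Z (c t)))"
  proof (intro convex_onI)
    fix s a b :: real
    assume cv: "convex_on UNIV (\<lambda>v. ln (Z (\<chi> i. exp (v $ i))))" and s: "0 < s" "s < 1"
    have eq: "u + ((1 - s) *\<^sub>R a + s *\<^sub>R b) *\<^sub>R (\<chi> i. w i)
        = (1 - s) *\<^sub>R (u + a *\<^sub>R (\<chi> i. w i)) + s *\<^sub>R (u + b *\<^sub>R (\<chi> i. w i))"
      by (simp add: algebra_simps)
    show "ln (Z (c ((1 - s) *\<^sub>R a + s *\<^sub>R b))) \<le> (1 - s) * ln (Z (c a)) + s * ln (Z (c b))"
      unfolding c_exp eq by (rule convex_onD[OF cv]) (use s in auto)
  qed auto
  have c_sum: "c = (\<lambda>t. \<Sum>i\<in>UNIV. (x $ i * exp (t * w i)) *\<^sub>R axis i 1)"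
    using basis_expansion[of "c _"]
    by (auto simp: c_def scalar_mult_eq_scaleR)
  have "(c has_vector_derivative (\<Sum>i\<in>UNIV. (x $ i * w i) *\<^sub>R axis i 1)) (at 0)"
    unfolding c_sum by (auto intro!: derivative_eq_intros simp: mult.commute)
  then have "((\<lambda>t. Z (c t)) has_real_derivative
      (\<Sum>k\<in>UNIV. (\<Sum>i\<in>UNIV. (x $ i * w i) *\<^sub>R axis i 1) $ k * partial_deriv Z k x)) (at 0)"
    by (rule has_real_derivative_along_curve[rotated])
      (simp only: c0 knee_jerk_has_derivative[OF Z x])
  moreover have "(\<Sum>k\<in>UNIV. (\<Sum>i\<in>UNIV. (x $ i * w i) *\<^sub>R axis i 1) $ k * partial_deriv Z k x)
      = (\<Sum>k\<in>UNIV. x $ k * partial_deriv Z k x * w k)"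
    using basis_expansion[of "\<chi> i. x $ i * w i"]
    by (simp add: scalar_mult_eq_scaleR mult_ac)
  ultimately have "((\<lambda>t. Z (c t)) has_real_derivative
      (\<Sum>k\<in>UNIV. x $ k * partial_deriv Z k x * w k)) (at 0)" by simp
  then have "((\<lambda>t. ln (Z (c t))) has_real_derivative
      (\<Sum>k\<in>UNIV. x $ k * partial_deriv Z k x * w k) / Z x) (at 0)"
    using Zx by (auto intro!: derivative_eq_intros simp: c0 divide_inverse)
  then have "ln (Z (c 1)) - ln (Z (c 0))
      \<ge> (\<Sum>k\<in>UNIV. x $ k * partial_deriv Z k x * w k) / Z x * (1 - 0)"
    by (intro convex_on_imp_above_tangent[OF conv]) auto
  then show ?thesis by (simp add: c0 c1 w_def)
qed

text \<open>The exponential form survives the passage to a boundary point \<open>y\<close>, where a priori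
  only \<open>Z y \<ge> 0\<close> is known.  Where \<open>y\<close> has a zero coordinate, \<open>ln (y $ i / x $ i)\<close> has no meaningful
  value, but the weight in front of it vanishes by assumption.\<close>

lemma log_tangent_inequality_boundary:
  fixes Z :: "real ^ 'n \<Rightarrow> real"
  assumes Z: "knee_jerk Z" and x: "x \<in> pos_orthant"
    and y: "\<And>i. 0 \<le> y $ i"
    and weight: "\<And>i. y $ i = 0 \<Longrightarrow> partial_deriv Z i x = 0"
  shows "Z y \<ge> Z x * exp ((\<Sum>i\<in>UNIV. x $ i * partial_deriv Z i x * ln (y $ i / x $ i)) / Z x)"
proof -
  let ?E = "(\<Sum>i\<in>UNIV. x $ i * partial_deriv Z i x * ln (y $ i / x $ i)) / Z x"
  define p :: "nat \<Rightarrow> real ^ 'n"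
    where "p m = (\<chi> i. if y $ i = 0 then inverse (real (Suc m)) else y $ i)" for m
  have p_pos: "p m \<in> pos_orthant" for m
    using y by (auto simp: p_def pos_orthant_def order_less_le)
  have p_lim: "p \<longlonglongrightarrow> y"
  proof (rule vec_tendstoI)
    show "(\<lambda>m. p m $ i) \<longlonglongrightarrow> y $ i" for i
      using LIMSEQ_inverse_real_of_nat by (cases "y $ i = 0") (auto simp: p_def)
  qed
  have "y \<in> closure pos_orthant"
    using p_pos p_lim unfolding closure_sequential by blast
  moreover have "p m \<in> closure pos_orthant" for m
    using p_pos closure_subset by blast
  moreover have "continuous_on (closure pos_orthant) Z"
    using Z by (simp add: knee_jerk_def)
  ultimately have lim: "(\<lambda>m. Z (p m)) \<longlonglongrightarrow> Z y"
    using p_lim by (auto intro: continuous_on_tendsto_compose)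
  have Zx: "0 < Z x" using Z x by (auto simp: knee_jerk_def)
  have "Z x * exp ?E \<le> Z (p m)" for m
  proof -
    have Zp: "0 < Z (p m)" using Z p_pos by (auto simp: knee_jerk_def)
    have "(\<Sum>i\<in>UNIV. x $ i * partial_deriv Z i x * ln (p m $ i / x $ i))
        = (\<Sum>i\<in>UNIV. x $ i * partial_deriv Z i x * ln (y $ i / x $ i))"
      by (rule sum.cong) (auto simp: p_def weight)
    with log_tangent_inequality[OF Z x p_pos[of m]] have "ln (Z x) + ?E \<le> ln (Z (p m))"
      by simp
    then have "exp (ln (Z x) + ?E) \<le> exp (ln (Z (p m)))" by simp
    then show ?thesis using Zx Zp by (simp add: exp_add)
  qed
  then show ?thesis by (intro LIMSEQ_le_const[OF lim]) blast
qed

section \<open>Gibbs' inequality\<close>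

text \<open>For positive \<open>s \<noteq> t\<close> the term \<open>s * ln (s / t)\<close> exceeds \<open>s - t\<close>, because \<open>ln r < r - 1\<close> for
  \<open>r = t / s \<noteq> 1\<close>; for \<open>s = 0\<close> it is \<open>0 > - t\<close>.  The differences \<open>s - t\<close> cancel in the sum.\<close>

lemma I_divergence_pos:
  fixes x y :: "real ^ 'n"
  assumes x: "\<And>i. 0 < x $ i" and y: "\<And>i. 0 \<le> y $ i"
    and sums: "(\<Sum>i\<in>UNIV. y $ i) = (\<Sum>i\<in>UNIV. x $ i)" and "y \<noteq> x"
  shows "0 < I_divergence y x"
proof -
  let ?g = "\<lambda>s t::real. if s = 0 then 0 else s * ln (s / t)"
  have strict: "s - t < ?g s t" if "0 \<le> s" "0 < t" "s \<noteq> t" for s t :: real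
  proof (cases "s = 0")
    case False
    with that have s: "0 < s" by simp
    have le: "ln (t / s) \<le> t / s - 1" using s that by (intro ln_le_minus_one) simp
    have "ln (t / s) \<noteq> t / s - 1"
      using ln_eq_minus_one[of "t / s"] s that by auto
    with le have "ln (t / s) < t / s - 1" by simp
    then have "s * ln (t / s) < s * (t / s - 1)" using s by simp
    moreover have "ln (t / s) = - ln (s / t)" using s that by (simp add: ln_div)
    ultimately show ?thesis using s by (simp add: algebra_simps)
  qed (use that in simp)
  have weak: "s - t \<le> ?g s t" if "0 \<le> s" "0 < t" for s t :: real
    using strict[of s t] that by (cases "s = t") auto
  obtain j where "y $ j \<noteq> x $ j" using \<open>y \<noteq> x\<close> by (auto simp: vec_eq_iff)
  then have "(\<Sum>i\<in>UNIV. y $ i - x $ i) < (\<Sum>i\<in>UNIV. ?g (y $ i) (x $ i))"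
    using weak[OF y x] strict[OF y x, of j j]
    by (intro sum_strict_mono_ex1) (blast | simp)+
  then show ?thesis using sums by (simp add: I_divergence_def sum_subtractf)
qed

lemma I_divergence_self:
  assumes "\<And>i. 0 < x $ i"
  shows "I_divergence x x = 0"
  unfolding I_divergence_def using assms by (intro sum.neutral) auto

section \<open>Critical points and the image point\<close>

lemma critical_point_iff_partial_derivs_eq:
  fixes Z :: "real ^ 'n \<Rightarrow> real"
  assumes Z: "knee_jerk Z" and x: "x \<in> open_simplex"
  shows "critical_point_on_simplex Z x \<longleftrightarrow> (\<forall>i j. partial_deriv Z i x = partial_deriv Z j x)"
proof -
  have xp: "x \<in> pos_orthant" using x by (simp add: open_simplex_def)
  note line = has_real_derivative_along_line[OF knee_jerk_has_derivative[OF Z xp]]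
  show ?thesis
  proof
    assume crit: "critical_point_on_simplex Z x"
    show "\<forall>i j. partial_deriv Z i x = partial_deriv Z j x"
    proof (intro allI)
      fix i j
      let ?v = "axis i 1 - axis j 1 :: real ^ 'n"
      have ax: "(\<Sum>k\<in>UNIV. axis m (1::real) $ k * h k) = h m" for m :: 'n and h
        by (simp add: axis_def if_distrib[of "\<lambda>a. a * _"] cong: if_cong)
      have "(\<Sum>k\<in>UNIV. ?v $ k) = 0"
        using ax[of _ "\<lambda>_. 1"] by (simp add: sum_subtractf)
      then have "((\<lambda>t. Z (x + t *\<^sub>R ?v)) has_real_derivative 0) (at 0)"
        using crit unfolding critical_point_on_simplex_def by blast
      then have "(\<Sum>k\<in>UNIV. ?v $ k * partial_deriv Z k x) = 0"
        using line[of ?v] by (rule DERIV_unique[rotated])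
      then show "partial_deriv Z i x = partial_deriv Z j x"
        by (simp add: left_diff_distrib sum_subtractf ax)
    qed
  next
    assume eq: "\<forall>i j. partial_deriv Z i x = partial_deriv Z j x"
    have "((\<lambda>t. Z (x + t *\<^sub>R v)) has_real_derivative 0) (at 0)"
      if "(\<Sum>i\<in>UNIV. v $ i) = 0" for v
    proof -
      obtain c where "\<And>i. partial_deriv Z i x = c" using eq by metis
      then have "(\<Sum>i\<in>UNIV. v $ i * partial_deriv Z i x) = 0"
        using that by (simp flip: sum_distrib_right)
      then show ?thesis using line[of v] by simp
    qed
    then show "critical_point_on_simplex Z x"
      using x by (simp add: critical_point_on_simplex_def)
  qed
qed

lemma knee_jerk_map_eq_self_iff:
  fixes Z :: "real ^ 'n \<Rightarrow> real"
  assumes x: "x \<in> open_simplex"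
    and D: "(\<Sum>i\<in>UNIV. x $ i * partial_deriv Z i x) \<noteq> 0"
  shows "knee_jerk_map Z x = x \<longleftrightarrow> (\<forall>i j. partial_deriv Z i x = partial_deriv Z j x)"
proof -
  let ?D = "\<Sum>i\<in>UNIV. x $ i * partial_deriv Z i x"
  have x0: "x $ i \<noteq> 0" for i using x by (auto simp: open_simplex_def pos_orthant_def less_le)
  have s1: "(\<Sum>i\<in>UNIV. x $ i) = 1" using x by (simp add: open_simplex_def)
  have "\<not> (\<forall>i. partial_deriv Z i x = 0)" using D sum.neutral by fastforce
  then have "knee_jerk_map Z x = x \<longleftrightarrow> (\<forall>i. partial_deriv Z i x = ?D)"
    unfolding knee_jerk_map_def using D x0 by (auto simp: vec_eq_iff field_simps)
  also have "\<dots> \<longleftrightarrow> (\<forall>i j. partial_deriv Z i x = partial_deriv Z j x)"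
  proof
    assume eq: "\<forall>i j. partial_deriv Z i x = partial_deriv Z j x"
    show "\<forall>i. partial_deriv Z i x = ?D"
    proof
      fix i
      obtain c where "\<And>k. partial_deriv Z k x = c" using eq by metis
      then show "partial_deriv Z i x = ?D" using s1 by (simp flip: sum_distrib_right)
    qed
  qed metis
  finally show ?thesis .
qed

(* In HOL ln 0 = 0, so the convention log 0 = -infinity is rendered by the separate
   conjunct that Z is positive at the image point. *)
theorem mainTheorem2:
  fixes Z :: "real ^ 'n \<Rightarrow> real" and x :: "real ^ 'n"
  assumes "knee_jerk Z"
    and "x \<in> open_simplex"
  shows "0 < Z (knee_jerk_map Z x) \<and>
    ln (Z (knee_jerk_map Z x) / Z x)
      \<ge> (\<Sum>i\<in>UNIV. x $ i * partial_deriv Z i x) / Z x * I_divergence (knee_jerk_map Z x) x \<and>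
    (\<Sum>i\<in>UNIV. x $ i * partial_deriv Z i x) / Z x * I_divergence (knee_jerk_map Z x) x \<ge> 0 \<and>
    (knee_jerk_map Z x \<noteq> x \<longrightarrow> Z (knee_jerk_map Z x) > Z x) \<and>
    (knee_jerk_map Z x = x \<longleftrightarrow> critical_point_on_simplex Z x)"
proof -
  let ?x' = "knee_jerk_map Z x"
  define D where "D = (\<Sum>i\<in>UNIV. x $ i * partial_deriv Z i x)"
  have xo: "x \<in> pos_orthant" and s1: "(\<Sum>i\<in>UNIV. x $ i) = 1"
    using assms(2) by (auto simp: open_simplex_def)
  have xp: "0 < x $ i" for i using xo by (simp add: pos_orthant_def)
  have Zx: "0 < Z x" using assms(1) xo by (auto simp: knee_jerk_def)
  note crit = critical_point_iff_partial_derivs_eq[OF assms]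
  have pd: "0 \<le> partial_deriv Z i x" for i
    by (rule knee_jerk_partial_deriv_nonneg[OF assms(1) xo])
  show ?thesis
  proof (cases "\<forall>i. partial_deriv Z i x = 0")
    case True
    then have "?x' = x" by (simp add: knee_jerk_map_def s1)
    moreover have "critical_point_on_simplex Z x" using True crit by simp
    ultimately show ?thesis using Zx True by simp
  next
    case False
    then obtain j where "0 < partial_deriv Z j x" using pd by (auto simp: order_less_le)
    then have "0 < x $ j * partial_deriv Z j x" using xp by simp
    then have D: "0 < D"
      unfolding D_def by (intro sum_pos2[of _ j]) (auto simp: pd less_imp_le[OF xp])
    have x': "?x' $ i = x $ i * partial_deriv Z i x / D" for i
      using False by (auto simp: knee_jerk_map_def D_def)
    have x'0: "0 \<le> ?x' $ i" for i
      using D pd[of i] xp[of i] by (simp add: x')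
    have "(\<Sum>i\<in>UNIV. ?x' $ i) = D / D"
      unfolding x' D_def by (rule sum_divide_distrib[symmetric])
    then have sums: "(\<Sum>i\<in>UNIV. ?x' $ i) = (\<Sum>i\<in>UNIV. x $ i)" using D s1 by simp
    have "Z x * exp ((\<Sum>i\<in>UNIV. x $ i * partial_deriv Z i x * ln (?x' $ i / x $ i)) / Z x)
        \<le> Z ?x'"
    proof (rule log_tangent_inequality_boundary[OF assms(1) xo x'0])
      show "partial_deriv Z i x = 0" if "?x' $ i = 0" for i
        using that D xp[of i] by (simp add: x')
    qed
    moreover have "(\<Sum>i\<in>UNIV. x $ i * partial_deriv Z i x * ln (?x' $ i / x $ i))
        = D * I_divergence ?x' x"
      unfolding I_divergence_def sum_distrib_left
      by (rule sum.cong) (use D in \<open>auto simp: x'\<close>)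
    ultimately have growth: "Z x * exp (D / Z x * I_divergence ?x' x) \<le> Z ?x'" by simp
    have Zx': "0 < Z ?x'"
      by (rule less_le_trans[OF _ growth]) (use Zx in simp)
    have "exp (D / Z x * I_divergence ?x' x) \<le> Z ?x' / Z x"
      using growth Zx by (simp add: field_simps)
    then have main: "D / Z x * I_divergence ?x' x \<le> ln (Z ?x' / Z x)"
      using Zx Zx' by (subst ln_ge_iff) auto
    have pos: "0 < D / Z x * I_divergence ?x' x" if "?x' \<noteq> x"
      using D Zx I_divergence_pos[OF xp x'0 sums that] by simp
    then have nonneg: "0 \<le> D / Z x * I_divergence ?x' x"
      using I_divergence_self[OF xp] by (cases "?x' = x") auto
    have "Z ?x' > Z x" if "?x' \<noteq> x"
    proof -
      have "0 < ln (Z ?x' / Z x)" using pos[OF that] main by simp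
      then show ?thesis using Zx Zx' by (simp add: ln_div)
    qed
    moreover have "?x' = x \<longleftrightarrow> critical_point_on_simplex Z x"
      using knee_jerk_map_eq_self_iff[OF assms(2)] D crit by (simp add: D_def)
    ultimately show ?thesis using Zx' main nonneg unfolding D_def by blast
  qed
qed

end
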